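(* Let $k$ be a field with $\operatorname{char} k\neq 3$ containing a primitive third root of unity $\omega$. Let $l=k(\alpha)$ be a cubic field extension of $k$ with $\alpha^3=b\in k^\times$, let $a\in k^\times$, let $A=(l,a)$ be a cyclic central simple division algebra over $k$ of degree $3$, and let $c\in k^\times$. If the cubic form $\langle c,a\rangle\otimes n_{l/k}$ represents $1$ or $a^2$, or the cubic form $\langle c,a^2\rangle\otimes n_{l/k}$ represents $1$ or $a$, then the Albert algebra $J=J(A,c)$ is not a Jordan division algebra.
   Context: Forms: $n_{l/k}$ is the norm of $l/k$, viewed as a cubic form on the 3-dimensional $k$-vector space $l$. For $e,f\in k^\times$, $\langle e,f\rangle\otimes n_{l/k}$ is the 6-dimensional cubic form $(x,y)\mapsto e\,n_{l/k}(x)+f\,n_{l/k}(y)$ on $l\oplus l$. A form represents $q\in k^\times$ if it takes the value $q$ at some vector with coordinates in $k$ (here: at some $(x,y)\in l\oplus l$). Cyclic algebras: let $\mu$ be a chosen generator of the Galois group of the cyclic cubic extension $l/k$. Then $(l,a)=l\oplus lz\oplus lz^2$ with multiplication determined by $z^3=a$ and $zu=\mu(u)z$ for $u\in l$; it is a central simple $k$-algebra of degree $3$. First Tits construction: let $A$ be a central simple associative algebra of degree $3$ over $k$ with reduced norm $n_{A/k}$, reduced trace $tr_{A/k}$ and adjoint $\sharp$ (the quadratic map with $u u^\sharp=u^\sharp u=n_{A/k}(u)1$), and let $c\in k^\times$. The vector space $V=A\oplus A\oplus A$ with $$N(a_1,a_2,a_3)=n_{A/k}(a_1)+c\,n_{A/k}(a_2)+c^{-1}n_{A/k}(a_3)-tr_{A/k}(a_1a_2a_3),$$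 $$(a_1,a_2,a_3)^\sharp=(a_1^\sharp-a_2a_3,\;c^{-1}a_3^\sharp-a_1a_2,\;c\,a_2^\sharp-a_3a_1),$$ $$T((a_1,a_2,a_3),(b_1,b_2,b_3))=tr_{A/k}(a_1b_1)+tr_{A/k}(a_2b_3)+tr_{A/k}(a_3b_2)$$ becomes a 27-dimensional central simple exceptional (quadratic, cubic) Jordan algebra, called an Albert algebra and denoted $J(A,c)$, with identity $(1,0,0)$ and $U$-operator $U_vw=T(v,w)v-v^\sharp\times w$, where $v\times w=(v+w)^\sharp-v^\sharp-w^\sharp$ is the bilinearization of $\sharp$. A Jordan division algebra is a nonzero Jordan algebra in which every nonzero element $v$ is invertible, i.e. $U_v$ is bijective for every $v\neq 0$. *)

theory Defs
  imports "HOL-Analysis.Analysis"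
begin

section \<open>Field extensions\<close>

text \<open>An extension \<open>l/k\<close> is given by a field homomorphism \<open>emb\<close> from the type \<open>'k\<close> to the type
  \<open>'l\<close>.\<close>

locale field_emb =
  fixes emb :: "'k::field \<Rightarrow> 'l::field"
  assumes emb_one: "emb 1 = 1"
    and emb_add: "emb (x + y) = emb x + emb y"
    and emb_mult: "emb (x * y) = emb x * emb y"

definition ext_scale :: "('k::field \<Rightarrow> 'l::field) \<Rightarrow> 'k \<Rightarrow> 'l \<Rightarrow> 'l" where
  "ext_scale emb t x = emb t * x"

definition ext_degree :: "('k::field \<Rightarrow> 'l::field) \<Rightarrow> nat" where
  "ext_degree emb = vector_space.dim (ext_scale emb) UNIV"

definition is_subfield :: "'l::field set \<Rightarrow> bool" where
  "is_subfield S \<longleftrightarrow> 1 \<in> S \<and> (\<forall>x\<in>S. \<forall>y\<in>S. x - y \<in> S \<and> x * y \<in> S) \<and> (\<forall>x\<in>S. inverse x \<in> S)"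

text \<open>The subfield \<open>k(\<alpha>)\<close> of \<open>l\<close>.\<close>

definition adjoin_elem :: "('k::field \<Rightarrow> 'l::field) \<Rightarrow> 'l \<Rightarrow> 'l set" where
  "adjoin_elem emb \<alpha> = is_subfield hull (insert \<alpha> (range emb))"

definition galois_group :: "('k::field \<Rightarrow> 'l::field) \<Rightarrow> ('l \<Rightarrow> 'l) set" where
  "galois_group emb = {\<sigma>. field_emb \<sigma> \<and> bij \<sigma> \<and> (\<forall>t. \<sigma> (emb t) = emb t)}"

text \<open>In a finite group the powers with exponents in \<open>\<nat>\<close> already form the generated subgroup.\<close>

definition galois_generator :: "('k::field \<Rightarrow> 'l::field) \<Rightarrow> ('l \<Rightarrow> 'l) \<Rightarrow> bool" where
  "galois_generator emb \<mu> \<longleftrightarrow> galois_group emb = range (\<lambda>n::nat. \<mu> ^^ n)"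

text \<open>The norm of a cubic extension: the determinant of multiplication by \<open>x\<close> on the \<open>k\<close>-vector
  space \<open>l\<close>, computed in a \<open>k\<close>-basis \<open>B\<close>, of which it is independent.\<close>

definition cubic_field_norm :: "('k::field \<Rightarrow> 'l::field) \<Rightarrow> 'l ^ 3 \<Rightarrow> 'l \<Rightarrow> 'k" where
  "cubic_field_norm emb B x =
    det (\<chi> i j. module.representation (ext_scale emb) (range (($) B)) (x * B $ j) (B $ i))"

section \<open>Cubic forms and quadratic maps\<close>

definition orth_two_form :: "'k::field \<Rightarrow> 'k \<Rightarrow> ('l \<Rightarrow> 'k) \<Rightarrow> 'l \<times> 'l \<Rightarrow> 'k" where
  "orth_two_form e f n = (\<lambda>(x, y). e * n x + f * n y)"

definition represents :: "('v \<Rightarrow> 'k) \<Rightarrow> 'k \<Rightarrow> bool" where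
  "represents F q \<longleftrightarrow> (\<exists>v. F v = q)"

definition polar :: "('v::ab_group_add \<Rightarrow> 'v) \<Rightarrow> 'v \<Rightarrow> 'v \<Rightarrow> 'v" where
  "polar q v w = q (v + w) - q v - q w"

text \<open>By symmetry of \<open>polar q\<close>, linearity in one argument is bilinearity.\<close>

definition quadratic_map :: "('k::field \<Rightarrow> 'v::ab_group_add \<Rightarrow> 'v) \<Rightarrow> ('v \<Rightarrow> 'v) \<Rightarrow> bool" where
  "quadratic_map s q \<longleftrightarrow>
    (\<forall>t v. q (s t v) = s (t\<^sup>2) (q v)) \<and>
    (\<forall>w. Vector_Spaces.linear s s (\<lambda>v. polar q v w))"

section \<open>Associative algebras of degree 3\<close>

record ('k, 'a) deg3_algebra =
  a_scale :: "'k \<Rightarrow> 'a \<Rightarrow> 'a"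
  a_mult :: "'a \<Rightarrow> 'a \<Rightarrow> 'a"
  a_one :: 'a
  nrd :: "'a \<Rightarrow> 'k"
  trd :: "'a \<Rightarrow> 'k"

definition division_algebra :: "('k, 'a::zero) deg3_algebra \<Rightarrow> bool" where
  "division_algebra A \<longleftrightarrow> a_one A \<noteq> 0 \<and>
    (\<forall>x. x \<noteq> 0 \<longrightarrow> (\<exists>y. a_mult A x y = a_one A \<and> a_mult A y x = a_one A))"

definition is_adjoint :: "('k::field, 'a::ab_group_add) deg3_algebra \<Rightarrow> ('a \<Rightarrow> 'a) \<Rightarrow> bool" where
  "is_adjoint A q \<longleftrightarrow> quadratic_map (a_scale A) q \<and>
    (\<forall>u. a_mult A u (q u) = a_scale A (nrd A u) (a_one A) \<and>
         a_mult A (q u) u = a_scale A (nrd A u) (a_one A))"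

text \<open>The quadratic map \<open>u \<mapsto> u\<^sup>\<sharp>\<close> determined by \<open>u u\<^sup>\<sharp> = u\<^sup>\<sharp> u = n(u) 1\<close>. Over a division algebra it is
  unique, since \<open>u\<^sup>\<sharp> = n(u) u\<^sup>-\<^sup>1\<close> for \<open>u \<noteq> 0\<close> and \<open>0\<^sup>\<sharp> = 0\<close>.\<close>

definition quad_adjoint :: "('k::field, 'a::ab_group_add) deg3_algebra \<Rightarrow> 'a \<Rightarrow> 'a" where
  "quad_adjoint A = (THE q. is_adjoint A q)"

text \<open>The cyclic algebra \<open>(l, a)\<close>: the triple \<open>(x\<^sub>0, x\<^sub>1, x\<^sub>2)\<close> stands for
  \<open>x\<^sub>0 + x\<^sub>1 z + x\<^sub>2 z\<^sup>2\<close>.\<close>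

fun cyclic_mult ::
  "('k::field \<Rightarrow> 'l::field) \<Rightarrow> ('l \<Rightarrow> 'l) \<Rightarrow> 'k \<Rightarrow> 'l \<times> 'l \<times> 'l \<Rightarrow> 'l \<times> 'l \<times> 'l \<Rightarrow> 'l \<times> 'l \<times> 'l" where
  "cyclic_mult emb \<mu> a (x0, x1, x2) (y0, y1, y2) =
    (x0 * y0 + emb a * (x1 * \<mu> y2 + x2 * \<mu> (\<mu> y1)),
     x0 * y1 + x1 * \<mu> y0 + emb a * (x2 * \<mu> (\<mu> y2)),
     x0 * y2 + x1 * \<mu> y1 + x2 * \<mu> (\<mu> y0))"

text \<open>Right multiplication is linear over \<open>l\<close> acting from the left; its matrix in the basis
  \<open>1, z, z\<^sup>2\<close> (acting on row vectors) embeds \<open>(l, a)\<close> into the 3 by 3 matrices over \<open>l\<close>. Reduced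
  norm and reduced trace are the determinant and trace in this splitting representation; they lie in
  the image of \<open>k\<close>, from which \<open>inv emb\<close> takes them back to \<open>k\<close>.\<close>

fun cyclic_rep ::
  "('k::field \<Rightarrow> 'l::field) \<Rightarrow> ('l \<Rightarrow> 'l) \<Rightarrow> 'k \<Rightarrow> 'l \<times> 'l \<times> 'l \<Rightarrow> 'l ^ 3 ^ 3" where
  "cyclic_rep emb \<mu> a (x0, x1, x2) = vector
    [vector [x0, x1, x2],
     vector [emb a * \<mu> x2, \<mu> x0, \<mu> x1],
     vector [emb a * \<mu> (\<mu> x1), emb a * \<mu> (\<mu> x2), \<mu> (\<mu> x0)]]"

definition cyclic_algebra ::
  "('k::field \<Rightarrow> 'l::field) \<Rightarrow> ('l \<Rightarrow> 'l) \<Rightarrow> 'k \<Rightarrow> ('k, 'l \<times> 'l \<times> 'l) deg3_algebra" where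
  "cyclic_algebra emb \<mu> a =
    \<lparr>a_scale = (\<lambda>t (x0, x1, x2). (emb t * x0, emb t * x1, emb t * x2)),
     a_mult = cyclic_mult emb \<mu> a,
     a_one = (1, 0, 0),
     nrd = (\<lambda>x. inv emb (det (cyclic_rep emb \<mu> a x))),
     trd = (\<lambda>x. inv emb (trace (cyclic_rep emb \<mu> a x)))\<rparr>"

section \<open>The first Tits construction\<close>

record ('k, 'v) cubic_jordan =
  j_scale :: "'k \<Rightarrow> 'v \<Rightarrow> 'v"
  j_norm :: "'v \<Rightarrow> 'k"
  j_sharp :: "'v \<Rightarrow> 'v"
  j_trace :: "'v \<Rightarrow> 'v \<Rightarrow> 'k"
  j_one :: 'v

definition U_op :: "('k, 'v::ab_group_add) cubic_jordan \<Rightarrow> 'v \<Rightarrow> 'v \<Rightarrow> 'v" where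
  "U_op J v w = j_scale J (j_trace J v w) v - polar (j_sharp J) (j_sharp J v) w"

definition first_tits ::
  "('k::field, 'a::ab_group_add) deg3_algebra \<Rightarrow> 'k \<Rightarrow> ('k, 'a \<times> 'a \<times> 'a) cubic_jordan" where
  "first_tits A c =
    \<lparr>j_scale = (\<lambda>t (a1, a2, a3). (a_scale A t a1, a_scale A t a2, a_scale A t a3)),
     j_norm = (\<lambda>(a1, a2, a3).
       nrd A a1 + c * nrd A a2 + inverse c * nrd A a3 - trd A (a_mult A (a_mult A a1 a2) a3)),
     j_sharp = (\<lambda>(a1, a2, a3).
       (quad_adjoint A a1 - a_mult A a2 a3,
        a_scale A (inverse c) (quad_adjoint A a3) - a_mult A a1 a2,
        a_scale A c (quad_adjoint A a2) - a_mult A a3 a1)),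
     j_trace = (\<lambda>(a1, a2, a3) (b1, b2, b3).
       trd A (a_mult A a1 b1) + trd A (a_mult A a2 b3) + trd A (a_mult A a3 b2)),
     j_one = (a_one A, 0, 0)\<rparr>"

text \<open>The Jordan identities are not part of this predicate: it is meant for structures such as
  \<open>first_tits A c\<close> that are known to be Jordan algebras, and omitting the identities makes its
  negation the stronger statement.\<close>

definition jordan_division :: "('k, 'v::ab_group_add) cubic_jordan \<Rightarrow> bool" where
  "jordan_division J \<longleftrightarrow> (\<exists>v::'v. v \<noteq> 0) \<and> (\<forall>v. v \<noteq> 0 \<longrightarrow> bij (U_op J v))"

end

theory Submission
  imports Defs
begin

text \<open>
  The cyclic algebra satisfies \<open>n(x + y z\<^sup>i) = n(x) + a\<^sup>i n(y)\<close> for \<open>i = 1, 2\<close> and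
  \<open>n(x z + y z\<^sup>2) = a n(x) + a\<^sup>2 n(y)\<close>, so each of the four hypotheses writes \<open>c n(x)\<close> as the reduced
  norm of a nonzero element \<open>p\<close>, for example \<open>p = 1 - y z\<close>. Hence \<open>c = n(u)\<close> for \<open>u = p x\<^sup>-\<^sup>1\<close>.
  Then \<open>w = (1, u\<^sup>-\<^sup>1, u)\<close> satisfies \<open>w\<^sup>\<sharp> = 0\<close>, so \<open>U\<^sub>w v = T(w, v) w\<close> has its image in the line
  through \<open>w\<close>, and \<open>U\<^sub>w\<close> is not surjective.
\<close>

section \<open>Field embeddings and inverses in finite-dimensional subspaces\<close>

context field_emb
begin

lemma emb_zero [simp]: "emb 0 = 0"
  using emb_add [of 0 0] by (metis add_cancel_left_left)

lemma emb_minus: "emb (- x) = - emb x"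
  using emb_add [of x "- x"] by (simp add: eq_neg_iff_add_eq_0 add.commute)

lemma emb_diff: "emb (x - y) = emb x - emb y"
  using emb_add [of x "- y"] by (simp add: emb_minus)

lemma emb_eq_0_iff [simp]: "emb x = 0 \<longleftrightarrow> x = 0"
proof
  assume "emb x = 0"
  show "x = 0"
  proof (rule ccontr)
    assume "x \<noteq> 0"
    then have "emb x * emb (inverse x) = 1"
      by (simp add: emb_one flip: emb_mult)
    with \<open>emb x = 0\<close> show False by simp
  qed
qed simp

lemma emb_eq_iff [simp]: "emb x = emb y \<longleftrightarrow> x = y"
  using emb_eq_0_iff [of "x - y"] by (simp add: emb_diff del: emb_eq_0_iff)

lemma emb_power: "emb (x ^ m) = emb x ^ m"
  by (induction m) (simp_all add: emb_one emb_mult)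

lemma inv_emb [simp]: "inv emb (emb x) = x"
  by (rule inv_f_f) (simp add: inj_def)

lemmas emb_simps = emb_add emb_mult emb_diff emb_minus emb_one

sublocale vs: vector_space "ext_scale emb"
  by unfold_locales (simp_all add: ext_scale_def emb_simps algebra_simps)

text \<open>Multiplication by \<open>x\<close> is an injective linear map of the finite-dimensional
  span into itself, hence onto, so \<open>1\<close> has a preimage.\<close>

lemma inverse_in_span:
  assumes "finite B" and "1 \<in> vs.span B" and "x \<noteq> 0"
    and closed: "\<And>y. y \<in> vs.span B \<Longrightarrow> x * y \<in> vs.span B"
  shows "inverse x \<in> vs.span B"
proof -
  obtain C where C: "C \<subseteq> B" "vs.independent C" "B \<subseteq> vs.span C"
    using vs.maximal_independent_subset by blast
  then have span_C: "vs.span C = vs.span B" and "finite C"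
    using vs.span_mono vs.span_eq assms(1) finite_subset by (metis subset_trans vs.span_superset)+
  interpret L: Vector_Spaces.linear "ext_scale emb" "ext_scale emb" "(*) x"
    by unfold_locales (simp_all add: ext_scale_def algebra_simps)
  have inj: "inj ((*) x)" using \<open>x \<noteq> 0\<close> by (simp add: inj_def)
  then have indep: "vs.independent ((*) x ` C)"
    using L.independent_inj_image C by blast
  \<comment> \<open>Otherwise \<open>{1} \<union> x C\<close> would be an independent set in \<open>vs.span C\<close> larger than \<open>C\<close>.\<close>
  have "1 \<in> vs.span ((*) x ` C)"
  proof (rule ccontr)
    assume *: "1 \<notin> vs.span ((*) x ` C)"
    then have "vs.independent (insert 1 ((*) x ` C))"
      using indep by (rule vs.independent_insertI)
    moreover have "insert 1 ((*) x ` C) \<subseteq> vs.span C"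
      using assms(2) closed span_C vs.span_superset by blast
    ultimately have "card (insert 1 ((*) x ` C)) \<le> card C"
      using vs.independent_span_bound \<open>finite C\<close> by blast
    moreover have "card (insert 1 ((*) x ` C)) = Suc (card C)"
    proof -
      have "1 \<notin> (*) x ` C" using * vs.span_base by blast
      moreover have "card ((*) x ` C) = card C"
        using inj card_image inj_on_subset subset_UNIV by blast
      ultimately show ?thesis using \<open>finite C\<close> by simp
    qed
    ultimately show False by simp
  qed
  then obtain y where "y \<in> vs.span C" "x * y = 1"
    by (auto simp: L.span_image)
  moreover from this have "y = inverse x"
    by (metis inverse_unique)
  ultimately show ?thesis by (simp add: span_C)
qed

end

section \<open>Reduced norm and adjoint of the cyclic algebra\<close>

locale cyclic_cubic = field_emb emb for emb :: "'k::field \<Rightarrow> 'l::field" +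
  fixes \<mu> :: "'l \<Rightarrow> 'l" and a :: 'k
  assumes field_emb_mu: "field_emb \<mu>"
    and mu_emb [simp]: "\<mu> (emb t) = emb t"
    and mu_mu_mu [simp]: "\<mu> (\<mu> (\<mu> x)) = x"
    and mu_fixed: "\<mu> x = x \<Longrightarrow> x \<in> range emb"
begin

sublocale mu: field_emb \<mu> by (rule field_emb_mu)

abbreviation A where "A \<equiv> cyclic_algebra emb \<mu> a"

text \<open>The norm of \<open>l/k\<close> as a product of conjugates, kept in \<open>l\<close>
  instead of being pulled back to \<open>k\<close>.\<close>

definition norm_prod :: "'l \<Rightarrow> 'l" where
  "norm_prod x = x * \<mu> x * \<mu> (\<mu> x)"

lemma norm_prod_inverse: "x \<noteq> 0 \<Longrightarrow> norm_prod x * norm_prod (inverse x) = 1"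
proof -
  assume "x \<noteq> 0"
  then have "x * inverse x = 1" by simp
  then have "norm_prod (x * inverse x) = 1"
    by (simp add: norm_prod_def mu.emb_one)
  then show ?thesis
    by (simp add: norm_prod_def mu.emb_mult mult_ac)
qed

definition cyclic_det :: "'l \<times> 'l \<times> 'l \<Rightarrow> 'l" where
  "cyclic_det x = det (cyclic_rep emb \<mu> a x)"

text \<open>Every mixed product involves all three coordinates. If one coordinate is zero, only a
  diagonal sum of norms remains; this is the source of the binary forms in the hypotheses.\<close>

lemma cyclic_det_eq:
  "cyclic_det (x0, x1, x2) = norm_prod x0 + emb a * norm_prod x1 + (emb a)\<^sup>2 * norm_prod x2
    - emb a * (x0 * \<mu> x1 * \<mu> (\<mu> x2) + x1 * \<mu> x2 * \<mu> (\<mu> x0) + x2 * \<mu> x0 * \<mu> (\<mu> x1))"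
  by (simp add: cyclic_det_def norm_prod_def det_3 algebra_simps power2_eq_square)

text \<open>The matrix describes right multiplication on row vectors, so the order of the factors is
  preserved. The entries agree because \<open>\<mu>\<close> has cube the identity and fixes
  \<open>emb a\<close>.\<close>

lemma cyclic_rep_mult:
  "cyclic_rep emb \<mu> a (cyclic_mult emb \<mu> a x y) = cyclic_rep emb \<mu> a x ** cyclic_rep emb \<mu> a y"
  by (cases x, cases y)
    (simp add: matrix_matrix_mult_def vec_eq_iff forall_3 sum_3 mu.emb_simps algebra_simps)

lemma cyclic_det_mult: "cyclic_det (cyclic_mult emb \<mu> a x y) = cyclic_det x * cyclic_det y"
  by (simp add: cyclic_det_def cyclic_rep_mult det_mul)

lemma cyclic_mult_assoc:
  "cyclic_mult emb \<mu> a (cyclic_mult emb \<mu> a x y) z = cyclic_mult emb \<mu> a x (cyclic_mult emb \<mu> a y z)"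
  by (cases x, cases y, cases z) (simp add: mu.emb_simps algebra_simps)

text \<open>\<open>\<mu>\<close> fixes each norm and permutes the three mixed products cyclically,
  so the determinant lies in the fixed field.\<close>

lemma emb_nrd [simp]: "emb (nrd A x) = cyclic_det x"
proof -
  obtain x0 x1 x2 where x: "x = (x0, x1, x2)" by (cases x)
  \<comment> \<open>\<open>nrd\<close> is defined through \<open>inv emb\<close>, which is meaningful only on the range of \<open>emb\<close>.\<close>
  have "\<mu> (cyclic_det x) = cyclic_det x"
    unfolding x cyclic_det_eq norm_prod_def
    by (simp add: mu.emb_simps power2_eq_square algebra_simps)
  from mu_fixed [OF this] obtain t where "cyclic_det x = emb t" by blast
  then show ?thesis
    by (simp add: cyclic_algebra_def flip: cyclic_det_def)
qed

lemma A_simps [simp]: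
  "a_scale A t (x0, x1, x2) = (emb t * x0, emb t * x1, emb t * x2)"
  "a_mult A = cyclic_mult emb \<mu> a"
  "a_one A = (1, 0, 0)"
  by (simp_all add: cyclic_algebra_def)

text \<open>The first row of the adjugate of \<open>cyclic_rep\<close>.\<close>

fun cyclic_adj :: "'l \<times> 'l \<times> 'l \<Rightarrow> 'l \<times> 'l \<times> 'l" where
  "cyclic_adj (x0, x1, x2) =
    (\<mu> x0 * \<mu> (\<mu> x0) - emb a * (\<mu> x1 * \<mu> (\<mu> x2)),
     emb a * (x2 * \<mu> (\<mu> x2)) - x1 * \<mu> (\<mu> x0),
     x1 * \<mu> x1 - x2 * \<mu> x0)"

lemma is_adjoint_cyclic_adj: "is_adjoint A cyclic_adj"
proof -
  interpret A_vs: vector_space "a_scale A"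
    by unfold_locales (auto simp: emb_simps algebra_simps)
  have "quadratic_map (a_scale A) cyclic_adj"
    unfolding quadratic_map_def
  proof (intro conjI allI)
    show "cyclic_adj (a_scale A t v) = a_scale A (t\<^sup>2) (cyclic_adj v)" for t v
      by (cases v) (simp add: mu.emb_simps emb_simps power2_eq_square algebra_simps)
    show "Vector_Spaces.linear (a_scale A) (a_scale A) (\<lambda>v. polar cyclic_adj v w)" for w
      by (cases w, unfold_locales) (auto simp: polar_def mu.emb_simps algebra_simps)
  qed
  moreover have "cyclic_mult emb \<mu> a u (cyclic_adj u) = a_scale A (nrd A u) (a_one A)
      \<and> cyclic_mult emb \<mu> a (cyclic_adj u) u = a_scale A (nrd A u) (a_one A)" for u
    by (cases u) (simp add: mu.emb_simps cyclic_det_eq norm_prod_def power2_eq_square algebra_simps)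
  ultimately show ?thesis
    by (simp add: is_adjoint_def)
qed

lemma cyclic_mult_one [simp]:
  "cyclic_mult emb \<mu> a x (1, 0, 0) = x" "cyclic_mult emb \<mu> a (1, 0, 0) x = x"
  by (cases x; simp add: mu.emb_one)+

lemma cyclic_mult_scale_one [simp]:
  "cyclic_mult emb \<mu> a x (a_scale A t (1, 0, 0)) = a_scale A t x"
  "cyclic_mult emb \<mu> a (a_scale A t (1, 0, 0)) x = a_scale A t x"
  by (cases x; simp)+

text \<open>Multiply the adjoint equation for \<open>x\<close> by \<open>y\<close> from the left.
  Besides uniqueness, this yields the adjoints of \<open>u\<close> and of its inverse in the Tits
  construction.\<close>

lemma is_adjoint_inverse:
  assumes "is_adjoint A q" and "cyclic_mult emb \<mu> a y x = (1, 0, 0)"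
  shows "q x = a_scale A (nrd A x) y"
proof -
  have "cyclic_mult emb \<mu> a x (q x) = a_scale A (nrd A x) (1, 0, 0)"
    using assms(1) unfolding is_adjoint_def A_simps(2,3) by blast
  then have "cyclic_mult emb \<mu> a (cyclic_mult emb \<mu> a y x) (q x) = a_scale A (nrd A x) y"
    by (simp add: cyclic_mult_assoc del: A_simps(1))
  with assms(2) show ?thesis by simp
qed

lemma is_adjoint_unique:
  assumes "division_algebra A" and "is_adjoint A q" and "is_adjoint A q'"
  shows "q = q'"
proof
  fix x
  show "q x = q' x"
  proof (cases "x = 0")
    case True
    have "r 0 = 0" if "is_adjoint A r" for r
    proof -
      \<comment> \<open>At zero the adjoint equation says nothing about \<open>r 0\<close>;
        quadratic homogeneity with factor \<open>0\<close> determines it.\<close>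
      have "r (a_scale A 0 0) = a_scale A (0\<^sup>2) (r 0)"
        using that unfolding is_adjoint_def quadratic_map_def by blast
      then show ?thesis by (cases "r 0") (simp add: zero_prod_def)
    qed
    with assms True show ?thesis by metis
  next
    case False
    with assms(1) obtain y where "cyclic_mult emb \<mu> a y x = (1, 0, 0)"
      unfolding division_algebra_def A_simps(2,3) by blast
    with assms show ?thesis
      by (metis is_adjoint_inverse)
  qed
qed

lemma quad_adjoint_eq: "division_algebra A \<Longrightarrow> quad_adjoint A = cyclic_adj"
  unfolding quad_adjoint_def
  by (rule the_equality) (auto intro: is_adjoint_cyclic_adj is_adjoint_unique)

section \<open>Elements with singular U-operator in the first Tits construction\<close>

lemma first_tits_not_division:
  assumes div: "division_algebra A" and u: "cyclic_mult emb \<mu> a u v = (1, 0, 0)"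
      "cyclic_mult emb \<mu> a v u = (1, 0, 0)"
    and c: "c \<noteq> 0" and det_u: "cyclic_det u = emb c"
  shows "\<not> jordan_division (first_tits A c)"
proof
  let ?J = "first_tits A c"
  define w where "w = ((1 :: 'l, 0 :: 'l, 0 :: 'l), v, u)"
  have det_v: "cyclic_det v = emb (inverse c)"
  proof -
    have "cyclic_det u * cyclic_det v = 1"
      using cyclic_det_mult [of u v] u by (simp add: cyclic_det_eq norm_prod_def mu.emb_one)
    also have "1 = emb c * emb (inverse c)"
      using c by (simp add: emb_one flip: emb_mult)
    finally show ?thesis
      using c det_u by simp
  qed
  have nrd: "nrd A u = c" "nrd A v = inverse c"
    using det_u det_v by (metis emb_eq_iff emb_nrd)+
  have scale: "a_scale A s (a_scale A t x) = a_scale A (s * t) x" for s t x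
    by (cases x) (simp add: emb_mult)
  \<comment> \<open>Since \<open>u\<close> and \<open>v\<close> have norms \<open>c\<close> and
    \<open>inverse c\<close>, these adjoints turn each component of the sharp of \<open>w\<close>
    into a difference of equal terms.\<close>
  have "cyclic_adj u = a_scale A c v" "cyclic_adj v = a_scale A (inverse c) u"
    using is_adjoint_inverse [OF is_adjoint_cyclic_adj u(2)]
      is_adjoint_inverse [OF is_adjoint_cyclic_adj u(1)] nrd by simp_all
  moreover have "a_scale A 1 x = x" for x
    by (cases x) (simp add: emb_one)
  ultimately have sharp_w: "j_sharp ?J w = 0"
    using c u
    by (simp add: w_def first_tits_def quad_adjoint_eq [OF div] scale zero_prod_def mu.emb_one)
  \<comment> \<open>As \<open>w\<close> has sharp zero, the U-operator subtracts the polarization at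
    the pair \<open>0\<close>, \<open>y\<close>, which vanishes once the sharp of \<open>0\<close>
    does.\<close>
  have sharp_0: "j_sharp ?J 0 = 0"
    by (simp add: first_tits_def quad_adjoint_eq [OF div] zero_prod_def)
  have U_w: "U_op ?J w y = j_scale ?J (j_trace ?J w y) w" for y
    unfolding U_op_def sharp_w
    by (simp add: polar_def sharp_0)
  assume "jordan_division ?J"
  moreover have "w \<noteq> 0" by (simp add: w_def zero_prod_def)
  ultimately have "surj (U_op ?J w)"
    unfolding jordan_division_def bij_def by blast
  \<comment> \<open>The identity element is not a multiple of \<open>w\<close>: the first component
    forces the factor 1, and the third then forces \<open>u = 0\<close>.\<close>
  then obtain y where "U_op ?J w y = ((1, 0, 0), 0, 0)"
    by (metis surjD)
  then obtain t where "j_scale ?J t w = ((1, 0, 0), 0, 0)"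
    by (metis U_w)
  then have "emb t = 1" and "a_scale A t u = 0"
    by (simp_all add: first_tits_def w_def)
  then have "u = 0"
    by (cases u) (simp add: zero_prod_def)
  with u show False
    by (cases v) (simp add: zero_prod_def)
qed

text \<open>Norms are multiplicative, so \<open>p\<close> times the inverse of \<open>x\<close> has
  norm \<open>c\<close>, and the division property makes it invertible.\<close>

lemma first_tits_not_division_of_norm:
  assumes div: "division_algebra A" and c: "c \<noteq> 0" and p: "p \<noteq> 0"
    and eq: "emb c * norm_prod x = cyclic_det p"
  shows "\<not> jordan_division (first_tits A c)"
proof -
  define inverse_elem where "inverse_elem x y \<longleftrightarrow>
    cyclic_mult emb \<mu> a x y = (1, 0, 0) \<and> cyclic_mult emb \<mu> a y x = (1, 0, 0)" for x y
  have ex_inv: "\<exists>y. inverse_elem x y" if "x \<noteq> 0" for x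
    using div that unfolding division_algebra_def inverse_elem_def A_simps(2,3) by blast
  have det_nz: "cyclic_det z \<noteq> 0" if "inverse_elem z y" for z y
    using cyclic_det_mult [of z y] that
    by (auto simp: inverse_elem_def cyclic_det_eq norm_prod_def mu.emb_one)
  \<comment> \<open>\<open>p\<close> is invertible, so its norm is nonzero, whereas
    \<open>x = 0\<close> would make it zero.\<close>
  have "x \<noteq> 0"
    using ex_inv [OF p] det_nz eq by (metis mult_zero_left mult_zero_right norm_prod_def)
  define u where "u = cyclic_mult emb \<mu> a p (inverse x, 0, 0)"
  have "cyclic_det u = cyclic_det p * norm_prod (inverse x)"
    by (simp add: u_def cyclic_det_mult) (simp add: cyclic_det_eq norm_prod_def)
  also have "\<dots> = emb c"
    using norm_prod_inverse [OF \<open>x \<noteq> 0\<close>] by (simp add: mult.assoc flip: eq)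
  finally have det_u: "cyclic_det u = emb c" .
  have "u \<noteq> 0"
    using det_u c by (auto simp: zero_prod_def cyclic_det_eq norm_prod_def)
  then obtain v where "inverse_elem u v" using ex_inv by blast
  then show ?thesis
    using first_tits_not_division [OF div _ _ c det_u] unfolding inverse_elem_def by blast
qed

end

section \<open>Coordinates, norm and an automorphism of a pure cubic extension\<close>

lemma root_of_unity_poly:
  fixes z :: "'c::field"
  assumes "z ^ 3 = 1" and "z \<noteq> 1"
  shows "z\<^sup>2 + z + 1 = 0"
proof -
  from assms(1) have "(z - 1) * (z\<^sup>2 + z + 1) = 0" by algebra
  with \<open>z \<noteq> 1\<close> show ?thesis by simp
qed

text \<open>The product rule of \<open>R[Y]/(Y^3 - d)\<close>, evaluated at a cube root
  \<open>y\<close> of \<open>d\<close>.\<close>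

lemma quadratic_mult_mod_cube:
  fixes r :: "'c::comm_ring_1"
  assumes "y ^ 3 = d"
  shows "(r + s * y + t * y\<^sup>2) * (r' + s' * y + t' * y\<^sup>2) =
    (r * r' + d * (s * t' + t * s')) + (r * s' + s * r' + d * (t * t')) * y
      + (r * t' + s * s' + t * r') * y\<^sup>2"
  unfolding assms [symmetric] by (simp add: power2_eq_square power3_eq_cube algebra_simps)

locale pure_cubic = field_emb emb for emb :: "'k::field \<Rightarrow> 'l::field" +
  fixes \<omega> b :: 'k and \<alpha> :: 'l
  assumes omega_cubed: "\<omega> ^ 3 = 1" and omega_ne_1: "\<omega> \<noteq> 1"
    and degree: "ext_degree emb = 3" and adjoin: "adjoin_elem emb \<alpha> = UNIV"
    and alpha_cubed: "\<alpha> ^ 3 = emb b" and b_nonzero: "b \<noteq> 0"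
begin

lemma alpha_nonzero: "\<alpha> \<noteq> 0"
  using alpha_cubed b_nonzero emb_eq_0_iff by fastforce

definition comb :: "'k \<Rightarrow> 'k \<Rightarrow> 'k \<Rightarrow> 'l" where
  "comb r s t = emb r + emb s * \<alpha> + emb t * \<alpha>\<^sup>2"

lemma comb_add: "comb r s t + comb r' s' t' = comb (r + r') (s + s') (t + t')"
  by (simp add: comb_def emb_simps algebra_simps)

lemma comb_mult:
  "comb r s t * comb r' s' t' =
    comb (r * r' + b * (s * t' + t * s')) (r * s' + s * r' + b * (t * t')) (r * t' + s * s' + t * r')"
  unfolding comb_def emb_simps by (rule quadratic_mult_mod_cube [OF alpha_cubed])

lemma comb_scalar: "comb r 0 0 = emb r"
  by (simp add: comb_def)

lemma comb_alpha: "comb 0 1 0 = \<alpha>"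
  by (simp add: comb_def emb_one)

lemma span_powers: "vs.span {1, \<alpha>, \<alpha>\<^sup>2} = {comb r s t | r s t. True}"
proof -
  have "x = comb r s t \<longleftrightarrow>
      x - ext_scale emb r 1 - ext_scale emb s \<alpha> - ext_scale emb t (\<alpha>\<^sup>2) = 0" for x r s t
    by (simp add: comb_def ext_scale_def algebra_simps)
  then show ?thesis
    by (simp add: vs.span_breakdown_eq set_eq_iff)
qed

text \<open>The span is a ring by the product rule and a field by finite dimension. It contains
  \<open>k\<close> and \<alpha>, hence all of \<open>k(\<alpha>) = l\<close>.\<close>

lemma span_powers_UNIV: "vs.span {1, \<alpha>, \<alpha>\<^sup>2} = UNIV"
proof -
  let ?S = "vs.span {1, \<alpha>, \<alpha>\<^sup>2}"
  have mult: "x * y \<in> ?S" if "x \<in> ?S" "y \<in> ?S" for x y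
    using that unfolding span_powers by (auto simp: comb_mult simp del: ex_simps) blast
  have one: "1 \<in> ?S" by (rule vs.span_base) simp
  have "inverse x \<in> ?S" if "x \<in> ?S" for x
  proof (cases "x = 0")
    case False
    then show ?thesis
      using inverse_in_span [OF _ one False] mult that by blast
  qed (simp add: vs.span_zero)
  then have "is_subfield ?S"
    unfolding is_subfield_def using mult one vs.span_diff by blast
  moreover have "insert \<alpha> (range emb) \<subseteq> ?S"
    unfolding span_powers using comb_scalar comb_alpha
    by (metis (mono_tags, lifting) image_subset_iff insert_subset mem_Collect_eq)
  ultimately have "adjoin_elem emb \<alpha> \<subseteq> ?S"
    unfolding adjoin_elem_def by (rule hull_minimal [rotated])
  with adjoin show ?thesis by auto
qed

lemma independent_powers: "vs.independent {1, \<alpha>, \<alpha>\<^sup>2}" and card_powers: "card {1, \<alpha>, \<alpha>\<^sup>2} = 3"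
proof -
  obtain C where C: "C \<subseteq> {1, \<alpha>, \<alpha>\<^sup>2}" "vs.independent C" "{1, \<alpha>, \<alpha>\<^sup>2} \<subseteq> vs.span C"
    using vs.maximal_independent_subset by blast
  then have "vs.span C = vs.span UNIV"
    using vs.span_minimal [of "{1, \<alpha>, \<alpha>\<^sup>2}"] span_powers_UNIV vs.subspace_span by auto
  then have "card C = 3"
    using vs.dim_eq_card C(2) degree by (simp add: ext_degree_def)
  moreover have "card {1, \<alpha>, \<alpha>\<^sup>2} \<le> 3"
    using card_insert_le_m1 [of 3] by (simp add: card_insert_if)
  ultimately have "C = {1, \<alpha>, \<alpha>\<^sup>2}"
    using C(1) by (metis card_seteq finite.emptyI finite.insertI)
  then show "vs.independent {1, \<alpha>, \<alpha>\<^sup>2}" "card {1, \<alpha>, \<alpha>\<^sup>2} = 3"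
    using C \<open>card C = 3\<close> by simp_all
qed

text \<open>Coordinates are indexed by the basis vectors themselves, so reading them off requires
  these vectors to differ.\<close>

lemma powers_distinct: "1 \<noteq> \<alpha>" "1 \<noteq> \<alpha>\<^sup>2" "\<alpha> \<noteq> \<alpha>\<^sup>2"
  using card_powers by (auto simp: card_insert_if split: if_splits)

definition coord :: "'l \<Rightarrow> 'l \<Rightarrow> 'k" where
  "coord = vs.representation {1, \<alpha>, \<alpha>\<^sup>2}"

lemma coord_comb [simp]:
  "coord (comb r s t) 1 = r" "coord (comb r s t) \<alpha> = s" "coord (comb r s t) (\<alpha>\<^sup>2) = t"
proof -
  have "comb r s t = ext_scale emb r 1 + ext_scale emb s \<alpha> + ext_scale emb t (\<alpha>\<^sup>2)"
    by (simp add: comb_def ext_scale_def)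
  then show "coord (comb r s t) 1 = r" "coord (comb r s t) \<alpha> = s" "coord (comb r s t) (\<alpha>\<^sup>2) = t"
    using powers_distinct powers_distinct [symmetric] independent_powers
    by (simp_all add: coord_def vs.representation_add vs.representation_scale vs.representation_basis
        span_powers_UNIV)
qed

lemma comb_cases: obtains r s t where "x = comb r s t"
  using span_powers span_powers_UNIV by blast

lemma comb_eq_iff: "comb r s t = comb r' s' t' \<longleftrightarrow> r = r' \<and> s = s' \<and> t = t'"
  by (metis coord_comb)

lemma cubic_field_norm_comb:
  "cubic_field_norm emb (vector [1, \<alpha>, \<alpha>\<^sup>2]) (comb r s t)
    = r ^ 3 + b * s ^ 3 + b\<^sup>2 * t ^ 3 - 3 * b * r * s * t"
proof -
  have range: "range (($) (vector [1, \<alpha>, \<alpha>\<^sup>2] :: 'l ^ 3)) = {1, \<alpha>, \<alpha>\<^sup>2}"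
    by (simp add: UNIV_3)
  \<comment> \<open>The columns of the multiplication matrix: a circulant whose entries above the
    diagonal are multiplied by \<open>b\<close>.\<close>
  have "comb r s t * 1 = comb r s t" "comb r s t * \<alpha> = comb (b * t) r s"
    "comb r s t * \<alpha>\<^sup>2 = comb (b * s) (b * t) r"
    using comb_mult [of r s t 0 1 0] comb_mult [of r s t 0 0 1]
    by (simp_all add: comb_alpha) (simp add: comb_def emb_one)
  then show ?thesis
    unfolding cubic_field_norm_def range coord_def [symmetric]
    by (simp add: det_3) (simp add: power2_eq_square power3_eq_cube algebra_simps)
qed

text \<open>A nontrivial automorphism of \<open>l/k\<close>: its existence excludes \<open>\<mu> = id\<close>.\<close>

definition twist :: "'l \<Rightarrow> 'l" where
  "twist x = comb (coord x 1) (\<omega> * coord x \<alpha>) (\<omega>\<^sup>2 * coord x (\<alpha>\<^sup>2))"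

lemma twist_comb: "twist (comb r s t) = comb r (\<omega> * s) (\<omega>\<^sup>2 * t)"
  by (simp add: twist_def)

lemma twist_emb: "twist (emb r) = emb r"
  using twist_comb [of r 0 0] by (simp add: comb_scalar)

text \<open>Scaling \<alpha> by \<omega> respects the relation \<open>\<alpha>^3 = b\<close> because
  \<open>\<omega>^3 = 1\<close>. For the same reason applying \<open>twist\<close> twice inverts
  it.\<close>

lemma twist_in_galois_group: "twist \<in> galois_group emb"
proof -
  have "twist (x + y) = twist x + twist y" for x y
    by (cases x rule: comb_cases, cases y rule: comb_cases)
      (simp add: twist_comb comb_add algebra_simps)
  moreover have "twist (x * y) = twist x * twist y" for x y
  proof -
    obtain r s t r' s' t' where xy: "x = comb r s t" "y = comb r' s' t'"
      using comb_cases by metis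
    show ?thesis
      unfolding xy twist_comb comb_mult comb_eq_iff
      by (intro conjI; (use omega_cubed in algebra | simp add: power2_eq_square algebra_simps))
  qed
  ultimately have "field_emb twist"
    using twist_emb [of 1] by unfold_locales (simp_all add: emb_one)
  moreover have "twist (twist (twist x)) = x" for x
  proof -
    obtain r s t where x: "x = comb r s t" by (rule comb_cases)
    show ?thesis
      unfolding x twist_comb comb_eq_iff
      by (intro conjI; (use omega_cubed in algebra | simp add: power2_eq_square algebra_simps))
  qed
  then have "bij twist"
    by (intro bij_betw_byWitness [where f' = "\<lambda>x. twist (twist x)"]) auto
  ultimately show ?thesis
    by (simp add: galois_group_def twist_emb)
qed

lemma twist_alpha: "twist \<alpha> \<noteq> \<alpha>"
  using twist_comb [of 0 1 0] omega_ne_1 comb_eq_iff [of 0 \<omega> 0 0 1 0]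
  by (simp add: comb_alpha)

end

section \<open>The Galois generator in coordinates\<close>

locale pure_cubic_galois = pure_cubic +
  fixes \<mu>
  assumes generator: "galois_generator emb \<mu>"
begin

lemma mu_in_galois_group: "\<mu> \<in> galois_group emb"
proof -
  have "\<mu> ^^ 1 \<in> galois_group emb"
    using generator unfolding galois_generator_def by blast
  then show ?thesis by simp
qed

sublocale mu: field_emb \<mu>
  using mu_in_galois_group by (simp add: galois_group_def)

lemma mu_emb [simp]: "\<mu> (emb r) = emb r"
  using mu_in_galois_group by (simp add: galois_group_def)

text \<open>If the generator fixed \<alpha>, so would all its powers, but \<open>twist\<close> is
  one of them and moves \<alpha>.\<close>

lemma mu_alpha_ne: "\<mu> \<alpha> \<noteq> \<alpha>"
proof
  assume "\<mu> \<alpha> = \<alpha>"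
  then have "(\<mu> ^^ m) \<alpha> = \<alpha>" for m
    by (induction m) simp_all
  moreover obtain m where "twist = \<mu> ^^ m"
    using twist_in_galois_group generator by (auto simp: galois_generator_def)
  ultimately show False
    using twist_alpha by metis
qed

text \<open>The quotient of \<open>\<mu> \<alpha>\<close> by \<alpha> is a cube root of unity other
  than 1. It is a root of \<open>X^2 + X + 1\<close>, which splits over \<open>k\<close> with roots
  \<omega> and \<open>\<omega>^2\<close>, so it lies in \<open>k\<close>.\<close>

lemma mu_alpha: obtains z where "z\<^sup>2 + z + 1 = 0" "\<mu> \<alpha> = emb z * \<alpha>"
proof -
  define y where "y = \<mu> \<alpha> / \<alpha>"
  have y: "\<mu> \<alpha> = y * \<alpha>" using alpha_nonzero by (simp add: y_def)
  have "(\<mu> \<alpha>) ^ 3 = \<alpha> ^ 3"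
    by (simp add: alpha_cubed flip: mu.emb_power)
  then have "y ^ 3 = 1" using alpha_nonzero by (simp add: y power_mult_distrib)
  moreover have "y \<noteq> 1" using mu_alpha_ne y by auto
  ultimately have y_poly: "y\<^sup>2 + y + 1 = 0" by (rule root_of_unity_poly)
  have omega_poly: "\<omega>\<^sup>2 + \<omega> + 1 = 0"
    using omega_cubed omega_ne_1 by (rule root_of_unity_poly)
  then have "(emb \<omega>)\<^sup>2 + emb \<omega> + 1 = 0"
    by (metis emb_add emb_one emb_power emb_zero)
  with y_poly have "(y - emb \<omega>) * (y - (emb \<omega>)\<^sup>2) = 0" by algebra
  then have "y = emb \<omega> \<or> y = emb (\<omega>\<^sup>2)" by (simp add: emb_power)
  moreover have "(\<omega>\<^sup>2)\<^sup>2 + \<omega>\<^sup>2 + 1 = 0" using omega_poly by algebra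
  ultimately show ?thesis
    using that omega_poly y by blast
qed

text \<open>Describing \<open>z\<close> by its equation covers both \<omega> and
  \<open>\<omega>^2\<close> without a case distinction.\<close>

lemma mu_comb:
  obtains z where "z\<^sup>2 + z + 1 = 0" "\<And>r s t. \<mu> (comb r s t) = comb r (z * s) (z\<^sup>2 * t)"
proof -
  obtain z where z: "z\<^sup>2 + z + 1 = 0" "\<mu> \<alpha> = emb z * \<alpha>" by (rule mu_alpha)
  then have "\<mu> (comb r s t) = comb r (z * s) (z\<^sup>2 * t)" for r s t
    by (simp add: comb_def mu.emb_simps mu.emb_power emb_simps emb_power power_mult_distrib)
  with z that show ?thesis by blast
qed

text \<open>The order divides three because \<open>z^3 = 1\<close>. A fixed element has zero
  coordinates at \<alpha> and \<open>\<alpha>^2\<close> because \<open>z\<close> and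
  \<open>z^2\<close> differ from 1.\<close>

lemma cyclic_cubic: "cyclic_cubic emb \<mu>"
proof
  obtain z where z: "z\<^sup>2 + z + 1 = 0" and mu: "\<And>r s t. \<mu> (comb r s t) = comb r (z * s) (z\<^sup>2 * t)"
    by (rule mu_comb) blast
  show "\<mu> (\<mu> (\<mu> x)) = x" for x
  proof -
    obtain r s t where x: "x = comb r s t" by (rule comb_cases)
    show ?thesis
      unfolding x mu comb_eq_iff by (intro conjI; (use z in algebra | simp))
  qed
  show "x \<in> range emb" if "\<mu> x = x" for x
  proof -
    obtain r s t where x: "x = comb r s t" by (rule comb_cases)
    have "z \<noteq> 1"
      using mu_alpha_ne mu [of 0 1 0] by (auto simp: comb_alpha)
    moreover have "z\<^sup>2 \<noteq> 1"
    proof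
      assume "z\<^sup>2 = 1"
      moreover have "z ^ 3 = 1" using z by algebra
      ultimately show False
        using \<open>z \<noteq> 1\<close> by (simp add: power3_eq_cube power2_eq_square)
    qed
    moreover have "z * s = s" "z\<^sup>2 * t = t"
      using that unfolding x mu comb_eq_iff by auto
    ultimately have "x = emb r"
      by (simp add: x comb_scalar)
    then show ?thesis by simp
  qed
qed simp

text \<open>Identifies the determinant norm of the hypotheses with the product of conjugates
  occurring in the reduced norm; both are compared in coordinates.\<close>

lemma emb_cubic_field_norm:
  "emb (cubic_field_norm emb (vector [1, \<alpha>, \<alpha>\<^sup>2]) x) = x * \<mu> x * \<mu> (\<mu> x)"
proof -
  obtain z where z: "z\<^sup>2 + z + 1 = 0" and mu: "\<And>r s t. \<mu> (comb r s t) = comb r (z * s) (z\<^sup>2 * t)"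
    by (rule mu_comb) blast
  obtain r s t where x: "x = comb r s t" by (rule comb_cases)
  show ?thesis
    unfolding x mu comb_mult cubic_field_norm_comb comb_scalar [symmetric] comb_eq_iff
    by (intro conjI; (use z in algebra | simp))
qed

end

theorem theorem2:
  fixes emb :: "'k::field \<Rightarrow> 'l::field"
    and \<omega> a b c :: 'k and \<alpha> :: 'l and \<mu> :: "'l \<Rightarrow> 'l"
    and n :: "'l \<Rightarrow> 'k" and A :: "('k, 'l \<times> 'l \<times> 'l) deg3_algebra"
  assumes "CHAR('k) \<noteq> 3"
    and "\<omega> ^ 3 = 1" and "\<And>m. 0 < m \<Longrightarrow> m < 3 \<Longrightarrow> \<omega> ^ m \<noteq> 1"
    and "field_emb emb" and "ext_degree emb = 3" and "adjoin_elem emb \<alpha> = UNIV"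
    and "\<alpha> ^ 3 = emb b" and "b \<noteq> 0"
    and "galois_generator emb \<mu>"
    and "n = cubic_field_norm emb (vector [1, \<alpha>, \<alpha>\<^sup>2])"
    and "a \<noteq> 0"
    and "A = cyclic_algebra emb \<mu> a" and "division_algebra A"
    and "c \<noteq> 0"
    and "represents (orth_two_form c a n) 1 \<or> represents (orth_two_form c a n) (a\<^sup>2) \<or>
         represents (orth_two_form c (a\<^sup>2) n) 1 \<or> represents (orth_two_form c (a\<^sup>2) n) a"
  shows "\<not> jordan_division (first_tits A c)"
proof -
  \<comment> \<open>The case \<open>m = 1\<close> of primitivity gives
    \<open>\<omega> \<noteq> 1\<close>.\<close>
  interpret pure_cubic_galois emb \<omega> b \<alpha> \<mu>
    using assms(3) [of 1] assms(2,4-9)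
    by (simp add: pure_cubic_galois_def pure_cubic_def pure_cubic_axioms_def
        pure_cubic_galois_axioms_def)
  interpret cyclic_cubic emb \<mu> a by (rule cyclic_cubic)
  have norm: "emb (n x) = norm_prod x" for x
    by (simp add: assms(10) emb_cubic_field_norm norm_prod_def)
  have div: "division_algebra (cyclic_algebra emb \<mu> a)"
    using assms(12,13) by simp
  have norm_0_1 [simp]: "norm_prod 0 = 0" "norm_prod 1 = 1" "norm_prod (- y) = - norm_prod y" for y
    by (simp_all add: norm_prod_def mu.emb_simps)
  have rep: "\<exists>x y. emb c * norm_prod x = emb q - emb e * norm_prod y"
    if "represents (orth_two_form c e n) q" for e q
  proof -
    from that obtain x y where "c * n x = q - e * n y"
      unfolding represents_def orth_two_form_def by (auto simp: eq_diff_eq)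
    then have "emb (c * n x) = emb (q - e * n y)" by simp
    then show ?thesis unfolding emb_simps norm by blast
  qed
  \<comment> \<open>In each case \<open>p\<close> has entry 1 where a norm is weighted by the
    represented value \<open>1\<close>, \<open>a\<close> or \<open>a^2\<close>, and entry
    \<open>- y\<close> at the weight of the second norm in the form. Oddness of the norm supplies
    the minus sign, and the entry 1 makes \<open>p\<close> nonzero.\<close>
  have "\<exists>x p. p \<noteq> 0 \<and> emb c * norm_prod x = cyclic_det p"
    using assms(15)
  proof (elim disjE)
    assume "represents (orth_two_form c a n) 1"
    from rep [OF this] obtain x y where "emb c * norm_prod x = emb 1 - emb a * norm_prod y" by blast
    then have "emb c * norm_prod x = cyclic_det (1, - y, 0)"
      by (simp add: cyclic_det_eq emb_one)
    then show ?thesis by (metis Pair_inject zero_neq_one zero_prod_def)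
  next
    assume "represents (orth_two_form c a n) (a\<^sup>2)"
    from rep [OF this] obtain x y where "emb c * norm_prod x = emb (a\<^sup>2) - emb a * norm_prod y" by blast
    then have "emb c * norm_prod x = cyclic_det (0, - y, 1)"
      by (simp add: cyclic_det_eq emb_power)
    then show ?thesis by (metis Pair_inject zero_neq_one zero_prod_def)
  next
    assume "represents (orth_two_form c (a\<^sup>2) n) 1"
    from rep [OF this] obtain x y where "emb c * norm_prod x = emb 1 - emb (a\<^sup>2) * norm_prod y" by blast
    then have "emb c * norm_prod x = cyclic_det (1, 0, - y)"
      by (simp add: cyclic_det_eq emb_one emb_power)
    then show ?thesis by (metis Pair_inject zero_neq_one zero_prod_def)
  next
    assume "represents (orth_two_form c (a\<^sup>2) n) a"
    from rep [OF this] obtain x y where "emb c * norm_prod x = emb a - emb (a\<^sup>2) * norm_prod y" by blast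
    then have "emb c * norm_prod x = cyclic_det (0, 1, - y)"
      by (simp add: cyclic_det_eq emb_power)
    then show ?thesis by (metis Pair_inject zero_neq_one zero_prod_def)
  qed
  then show ?thesis
    using first_tits_not_division_of_norm [OF div assms(14)] assms(12) by blast
qed

end
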